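(* Let $G$ be a graph and $\theta$ a real number. A set $X\subseteq V(G)$ is a maximal (under inclusion) $\theta$-Tutte set in $G$ if and only if $X$ is a maximal (under inclusion) $\theta$-extreme set in $G$.
   Context: All graphs are finite and simple. For a graph $G$ on $n$ vertices, let $p(G,r)$ be the number of $r$-matchings of $G$ ($p(G,0)=1$); the matching polynomial is $\mu(G,x)=\sum_{r=0}^{\lfloor n/2\rfloor}(-1)^r p(G,r)x^{n-2r}$ (the graph with no vertices has $\mu=1$). For real $\theta$, $\mathrm{mult}(\theta,G)$ is the multiplicity of $\theta$ as a root of $\mu(G,x)$ (it is $0$ if $\theta$ is not a root). For $X\subseteq V(G)$, $G\setminus X$ is the graph obtained by deleting the vertices of $X$ and their incident edges; $G\setminus u$ means $G\setminus\{u\}$. A vertex $u$ is $\theta$-essential in $G$ if $\mathrm{mult}(\theta,G\setminus u)=\mathrm{mult}(\theta,G)-1$. A connected graph is $\theta$-critical if every one of its vertices is $\theta$-essential in it; $c_\theta(G)$ denotes the number of connected components of $G$ that are $\theta$-critical. A set $X\subseteq V(G)$ is a $\theta$-Tutte set if $c_\theta(G\setminus X)=\mathrm{mult}(\theta,G)+|X|$, and a $\theta$-extreme set if $\mathrm{mult}(\theta,G\setminus X)=\mathrm{mult}(\theta,G)+|X|$. *)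

theory Defs
  imports "HOL-Computational_Algebra.Polynomial"
begin

definition simple_graph :: "'a set \<Rightarrow> 'a set set \<Rightarrow> bool" where
  "simple_graph V E \<longleftrightarrow> finite V \<and> (\<forall>e\<in>E. card e = 2 \<and> e \<subseteq> V)"

definition del_verts_V :: "'a set \<Rightarrow> 'a set \<Rightarrow> 'a set" where
  "del_verts_V V X = V - X"

definition del_verts_E :: "'a set set \<Rightarrow> 'a set \<Rightarrow> 'a set set" where
  "del_verts_E E X = {e\<in>E. e \<inter> X = {}}"

definition is_matching :: "'a set set \<Rightarrow> 'a set set \<Rightarrow> bool" where
  "is_matching E M \<longleftrightarrow> M \<subseteq> E \<and> (\<forall>e\<in>M. \<forall>f\<in>M. e \<noteq> f \<longrightarrow> e \<inter> f = {})"

definition num_matchings :: "'a set set \<Rightarrow> nat \<Rightarrow> nat" where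
  "num_matchings E r = card {M. is_matching E M \<and> card M = r}"

definition match_poly :: "'a set \<Rightarrow> 'a set set \<Rightarrow> real poly" where
  "match_poly V E = (\<Sum>r\<le>card V div 2.
      monom ((-1) ^ r * real (num_matchings E r)) (card V - 2 * r))"

definition mult :: "real \<Rightarrow> 'a set \<Rightarrow> 'a set set \<Rightarrow> nat" where
  "mult \<theta> V E = order \<theta> (match_poly V E)"

definition essential :: "real \<Rightarrow> 'a set \<Rightarrow> 'a set set \<Rightarrow> 'a \<Rightarrow> bool" where
  "essential \<theta> V E u \<longleftrightarrow>
     int (mult \<theta> (del_verts_V V {u}) (del_verts_E E {u})) = int (mult \<theta> V E) - 1"

definition reach :: "'a set set \<Rightarrow> 'a \<Rightarrow> 'a \<Rightarrow> bool" where
  "reach E = (\<lambda>u v. {u, v} \<in> E)\<^sup>*\<^sup>*"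

definition connected_graph :: "'a set \<Rightarrow> 'a set set \<Rightarrow> bool" where
  "connected_graph V E \<longleftrightarrow> V \<noteq> {} \<and> (\<forall>u\<in>V. \<forall>v\<in>V. reach E u v)"

definition critical :: "real \<Rightarrow> 'a set \<Rightarrow> 'a set set \<Rightarrow> bool" where
  "critical \<theta> V E \<longleftrightarrow> connected_graph V E \<and> (\<forall>u\<in>V. essential \<theta> V E u)"

definition components :: "'a set \<Rightarrow> 'a set set \<Rightarrow> 'a set set" where
  "components V E = {{v\<in>V. reach E u v} | u. u \<in> V}"

definition induced_E :: "'a set set \<Rightarrow> 'a set \<Rightarrow> 'a set set" where
  "induced_E E C = {e\<in>E. e \<subseteq> C}"

definition c_crit :: "real \<Rightarrow> 'a set \<Rightarrow> 'a set set \<Rightarrow> nat" where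
  "c_crit \<theta> V E = card {C\<in>components V E. critical \<theta> C (induced_E E C)}"

definition tutte_set :: "real \<Rightarrow> 'a set \<Rightarrow> 'a set set \<Rightarrow> 'a set \<Rightarrow> bool" where
  "tutte_set \<theta> V E X \<longleftrightarrow> X \<subseteq> V \<and>
     c_crit \<theta> (del_verts_V V X) (del_verts_E E X) = mult \<theta> V E + card X"

definition extreme_set :: "real \<Rightarrow> 'a set \<Rightarrow> 'a set set \<Rightarrow> 'a set \<Rightarrow> bool" where
  "extreme_set \<theta> V E X \<longleftrightarrow> X \<subseteq> V \<and>
     mult \<theta> (del_verts_V V X) (del_verts_E E X) = mult \<theta> V E + card X"

definition maximal_tutte_set :: "real \<Rightarrow> 'a set \<Rightarrow> 'a set set \<Rightarrow> 'a set \<Rightarrow> bool" where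
  "maximal_tutte_set \<theta> V E X \<longleftrightarrow> tutte_set \<theta> V E X \<and>
     (\<forall>Y. X \<subset> Y \<longrightarrow> \<not> tutte_set \<theta> V E Y)"

definition maximal_extreme_set :: "real \<Rightarrow> 'a set \<Rightarrow> 'a set set \<Rightarrow> 'a set \<Rightarrow> bool" where
  "maximal_extreme_set \<theta> V E X \<longleftrightarrow> extreme_set \<theta> V E X \<and>
     (\<forall>Y. X \<subset> Y \<longrightarrow> \<not> extreme_set \<theta> V E Y)"

end

theory Submission
  imports Complex_Main Defs
begin

text \<open>
  Everything rests on the Heilmann--Lieb inequality
  \<open>\<mu>(G - u) \<mu>(G - v) - \<mu>(G) \<mu>(G - u - v) \<ge> 0\<close>, which holds pointwise and even
  for matching polynomials with arbitrary real vertex weights; for adjacent \<open>u\<close>, \<open>v\<close> the left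
  side is at least \<open>\<mu>(G - u - v)\<^sup>2\<close>. Comparing orders of vanishing at \<open>\<theta>\<close> gives
  interlacing and shows that a non-essential neighbour of an essential vertex raises the
  multiplicity when deleted. Call essential vertices \<open>u\<close>, \<open>v\<close> parallel if deleting both
  decreases the multiplicity by at most one. Adjacent essential vertices are parallel, and
  parallelism is transitive, so a connected graph with all vertices essential has multiplicity one
  (the analogue of Gallai's lemma). If \<open>X\<close> is a maximal extreme set, no vertex of \<open>G - X\<close>
  raises the multiplicity, so each component of \<open>G - X\<close> either is critical, of multiplicity one, or
  has multiplicity zero; hence \<open>X\<close> is a Tutte set. Conversely, critical components have positive
  multiplicity, so by interlacing every Tutte set is extreme.
\<close>

section \<open>Orders of nonnegative polynomials\<close>

lemma zero_le_mult_imp_nonneg: "(a::real) > 0 \<Longrightarrow> a * b \<ge> 0 \<Longrightarrow> b \<ge> 0"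
  by (simp add: zero_le_mult_iff)

text \<open>Recovers a sign at \<open>a\<close> itself after a power of \<open>x - a\<close> has
  been cancelled, which is possible only for \<open>x \<noteq> a\<close>.\<close>

lemma poly_nonneg_limit:
  fixes p :: "real poly"
  assumes "\<And>x. x \<noteq> a \<Longrightarrow> poly p x \<ge> 0"
  shows "poly p a \<ge> 0"
proof (rule tendsto_lowerbound)
  show "((\<lambda>x. poly p x) \<longlongrightarrow> poly p a) (at a)"
    using poly_DERIV[of p a] DERIV_isCont isCont_def by blast
  show "\<forall>\<^sub>F x in at a. 0 \<le> poly p x"
    using assms by (auto simp: eventually_at_filter)
qed simp

text \<open>If the order were odd, cancelling the largest even power of \<open>x - a\<close> would
  leave a nonnegative \<open>q\<close> with a simple zero at \<open>a\<close>. But \<open>a\<close>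
  is then a minimum of \<open>q\<close>, so its derivative vanishes there as well.\<close>

lemma order_nonneg_even:
  fixes p :: "real poly"
  assumes nn: "\<And>x. poly p x \<ge> 0" and "p \<noteq> 0"
  shows "even (order a p)"
proof (rule ccontr)
  assume "odd (order a p)"
  then obtain m where m: "order a p = 2 * m + 1" by (elim oddE)
  obtain r where r: "p = [:-a, 1:] ^ (2 * m + 1) * r" "\<not> [:-a, 1:] dvd r"
    using order_decomp[OF \<open>p \<noteq> 0\<close>, of a] unfolding m by blast
  define q where "q = [:-a, 1:] * r"
  have p_eq: "p = ([:-a, 1:] ^ m)\<^sup>2 * q"
    unfolding r(1) q_def by (simp only: power_add power_even_eq power_one_right mult.assoc)
  have "poly q x \<ge> 0" if "x \<noteq> a" for x
  proof -
    have "(poly ([:-a, 1:] ^ m) x)\<^sup>2 > 0" using that by simp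
    moreover have "(poly ([:-a, 1:] ^ m) x)\<^sup>2 * poly q x \<ge> 0"
      using nn[of x] unfolding p_eq by simp
    ultimately show ?thesis by (rule zero_le_mult_imp_nonneg)
  qed
  moreover have q0: "poly q a = 0" by (simp add: q_def)
  ultimately have "\<forall>y. \<bar>a - y\<bar> < 1 \<longrightarrow> poly q a \<le> poly q y"
    by (metis order_refl)
  with DERIV_local_min[OF poly_DERIV[of q a], of 1] have "poly (pderiv q) a = 0" by simp
  then have "poly r a = 0" by (simp add: q_def pderiv_mult pderiv_pCons del: mult_pCons_left)
  with r(2) show False by (simp add: poly_eq_0_iff_dvd)
qed

text \<open>If \<open>p\<close> vanished to higher order than the square of \<open>q\<close>,
  dividing by \<open>(x - a) ^ (2 * m)\<close> and letting \<open>x\<close> tend to \<open>a\<close>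
  would leave minus the square of \<open>poly s a\<close> nonnegative, although the cofactor
  \<open>s\<close> is nonzero at \<open>a\<close>.\<close>

lemma order_ge_square:
  fixes p q :: "real poly"
  assumes ge: "\<And>x. poly p x \<ge> (poly q x)\<^sup>2" and "q \<noteq> 0"
  shows "p \<noteq> 0" "order a p \<le> 2 * order a q"
proof -
  show "p \<noteq> 0"
  proof
    assume "p = 0"
    with ge have "poly q x = 0" for x by (metis poly_0 power2_less_eq_zero_iff)
    with \<open>q \<noteq> 0\<close> show False using poly_all_0_iff_0 by blast
  qed
  define m where "m = order a q"
  obtain s where s: "q = [:-a, 1:] ^ m * s" "\<not> [:-a, 1:] dvd s"
    using order_decomp[OF \<open>q \<noteq> 0\<close>, of a] unfolding m_def by blast
  show "order a p \<le> 2 * order a q"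
  proof (rule ccontr)
    assume "\<not> ?thesis"
    then have "[:-a, 1:] ^ (2 * m + 1) dvd p" 
      using order_1 power_le_dvd by (metis m_def Suc_eq_plus1 not_less_eq_eq)
    then obtain r where r: "p = [:-a, 1:] ^ (2 * m + 1) * r" by (elim dvdE)
    have "poly ([:-a, 1:] * r - s\<^sup>2) x \<ge> 0" if "x \<noteq> a" for x
    proof -
      have pos: "(x - a) ^ (2 * m) > 0" using that by (simp add: power_mult)
      have "(x - a) ^ (2 * m) * ((x - a) * poly r x - (poly s x)\<^sup>2) \<ge> 0"
        using ge[of x] unfolding r s(1)
        by (simp add: power_mult_distrib algebra_simps flip: power_mult)
      then have "(x - a) * poly r x - (poly s x)\<^sup>2 \<ge> 0"
      using pos by (rule zero_le_mult_imp_nonneg[rotated])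
    then show ?thesis by (simp add: algebra_simps)
    qed
    then have "poly ([:-a, 1:] * r - s\<^sup>2) a \<ge> 0" by (rule poly_nonneg_limit)
    then have "poly s a = 0" by simp
    with s(2) show False by (simp add: poly_eq_0_iff_dvd)
  qed
qed

lemma power_dvd_pderiv:
  fixes p :: "real poly"
  shows "[:-a, 1:] ^ Suc n dvd p \<Longrightarrow> [:-a, 1:] ^ n dvd pderiv p"
proof (induction n arbitrary: p)
  case (Suc n)
  then obtain q where p: "p = [:-a, 1:] * q" and q: "[:-a, 1:] ^ Suc n dvd q"
    by (metis dvdE dvd_mult_cancel_left dvd_triv_left mult.assoc power_Suc)
  have "pderiv p = [:-a, 1:] * pderiv q + q"
    unfolding p by (simp add: pderiv_mult pderiv_pCons del: mult_pCons_left)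
  moreover have "[:-a, 1:] ^ Suc n dvd [:-a, 1:] * pderiv q"
    unfolding power_Suc using Suc.IH[OF q] by (rule mult_dvd_mono[OF dvd_refl])
  ultimately show ?case using q by (metis dvd_add)
qed simp

section \<open>Connected components\<close>

lemma induced_E_induced_E: "C \<subseteq> S \<Longrightarrow> induced_E (induced_E E S) C = induced_E E C"
  by (auto simp: induced_E_def)

lemma reach_sym: "reach E u v \<Longrightarrow> reach E v u"
  unfolding reach_def by (rule sympD[OF symp_rtranclp]) (auto simp: symp_def insert_commute)

lemma reach_trans: "reach E u v \<Longrightarrow> reach E v w \<Longrightarrow> reach E u w"
  unfolding reach_def by (rule rtranclp_trans)

lemma Union_components: "\<Union>(components V E) = V"
  unfolding components_def by (auto simp: reach_def)

lemma components_disjoint: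
  assumes "C \<in> components V E" "D \<in> components V E" "C \<noteq> D"
  shows "C \<inter> D = {}"
proof (rule ccontr)
  assume "C \<inter> D \<noteq> {}"
  moreover obtain u v where CD: "C = {x \<in> V. reach E u x}" "D = {x \<in> V. reach E v x}"
    using assms unfolding components_def by auto
  ultimately obtain x where "reach E u x" "reach E v x" by auto
  then have "reach E u v" by (meson reach_sym reach_trans)
  then have "C = D" unfolding CD by (meson reach_sym reach_trans)
  with assms show False by simp
qed

lemma edge_within_component:
  assumes "{v, w} \<in> E" "v \<in> V" "w \<in> V"
  shows "\<exists>C\<in>components V E. {v, w} \<subseteq> C"
proof -
  have "reach E v v" "reach E v w" using assms(1) by (auto simp: reach_def)
  then have "{v, w} \<subseteq> {x \<in> V. reach E v x}" using assms by auto
  then show ?thesis using assms(2) unfolding components_def by blast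
qed

lemma connected_component:
  assumes C: "C \<in> components V E" and E: "\<And>e. e \<in> E \<Longrightarrow> e \<subseteq> V"
  shows "connected_graph C (induced_E E C)"
proof -
  obtain u where u: "u \<in> V" and C_eq: "C = {x \<in> V. reach E u x}"
    using C unfolding components_def by auto
  \<comment> \<open>Every vertex on a walk from \<open>u\<close> is itself reachable from
    \<open>u\<close>, so the walk never leaves \<open>C\<close>.\<close>
  have *: "reach (induced_E E C) u v" if "reach E u v" for v
    using that unfolding reach_def
  proof (induction rule: rtranclp_induct)
    case (step v w)
    have "reach E u v" "reach E u w" using step(1,2)
      by (auto simp: reach_def intro: rtranclp.rtrancl_into_rtrancl)
    with E[OF step(2)] have "{v, w} \<in> induced_E E C"
      using step(2) by (simp add: induced_E_def C_eq)
    with step.IH show ?case by (rule rtranclp.rtrancl_into_rtrancl)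
  qed simp
  have "reach E u u" by (simp add: reach_def)
  then have "C \<noteq> {}" using u C_eq by auto
  moreover have "reach (induced_E E C) v w" if "v \<in> C" "w \<in> C" for v w
    using * that C_eq by (metis (no_types, lifting) mem_Collect_eq reach_sym reach_trans)
  ultimately show ?thesis by (simp add: connected_graph_def)
qed

section \<open>Weighted matching polynomials of induced subgraphs\<close>

locale matching_graph =
  fixes E :: "'a set set" and \<theta> :: real
  assumes card_edge: "e \<in> E \<Longrightarrow> card e = 2"
begin

definition matchings :: "'a set \<Rightarrow> 'a set set set" where
  "matchings S = {M. is_matching (induced_E E S) M}"

text \<open>The graph on \<open>S\<close> is the one induced by \<open>E\<close>. Replacing the variable by a weight
  \<open>h v\<close> for each vertex allows the weight of a single vertex to be perturbed later on.\<close>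

definition wm :: "('a \<Rightarrow> real) \<Rightarrow> 'a set \<Rightarrow> real" where
  "wm h S = (\<Sum>M\<in>matchings S. (-1) ^ card M * (\<Prod>v\<in>S - \<Union>M. h v))"

definition nbrs :: "'a set \<Rightarrow> 'a \<Rightarrow> 'a set" where
  "nbrs S v = {w \<in> S - {v}. {v, w} \<in> E}"

definition mp :: "'a set \<Rightarrow> real poly" where
  "mp S = match_poly S (induced_E E S)"

definition m :: "'a set \<Rightarrow> nat" where
  "m S = order \<theta> (mp S)"

lemma matchings_subset: "M \<in> matchings S \<Longrightarrow> M \<subseteq> Pow S"
  by (auto simp: matchings_def is_matching_def induced_E_def)

lemma finite_matchings: "finite S \<Longrightarrow> finite (matchings S)"
  by (rule finite_subset[of _ "Pow (Pow S)"]) (use matchings_subset in auto)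

lemma finite_matching: "finite S \<Longrightarrow> M \<in> matchings S \<Longrightarrow> finite M"
  using matchings_subset finite_subset by (metis finite_Pow_iff)

lemma finite_nbrs: "finite S \<Longrightarrow> finite (nbrs S v)"
  by (simp add: nbrs_def)

lemma matchings_split:
  assumes "v \<in> S"
  shows "matchings S = matchings (S - {v}) \<union>
    (\<Union>w\<in>nbrs S v. insert {v, w} ` matchings (S - {v, w}))" (is "_ = ?A \<union> ?B")
proof (intro equalityI subsetI)
  fix M assume M: "M \<in> matchings S"
  show "M \<in> ?A \<union> ?B"
  proof (cases "v \<in> \<Union>M")
    case False
    with M have "M \<in> ?A"
      by (auto simp: matchings_def is_matching_def induced_E_def)
    then show ?thesis ..
  next
    case True
    then obtain e where e: "e \<in> M" "v \<in> e" by auto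
    with M have eE: "e \<in> E" "e \<subseteq> S" by (auto simp: matchings_def is_matching_def induced_E_def)
    from card_edge[OF eE(1)] e(2) obtain w where w: "e = {v, w}" "w \<noteq> v"
      by (auto simp: card_2_iff doubleton_eq_iff)
    have pdM: "f \<inter> g = {}" if "f \<in> M" "g \<in> M" "f \<noteq> g" for f g
      using M that by (simp add: matchings_def is_matching_def)
    have disj: "f \<inter> {v, w} = {}" if "f \<in> M - {e}" for f
      using pdM[of f e] e(1) that w(1) by simp
    have "M - {e} \<in> matchings (S - {v, w})"
      unfolding matchings_def is_matching_def induced_E_def mem_Collect_eq
    proof (intro conjI subsetI ballI impI)
      fix f assume f: "f \<in> M - {e}"
      with M have "f \<in> E" "f \<subseteq> S" by (auto simp: matchings_def is_matching_def induced_E_def)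
      with disj[OF f] show "f \<in> {e \<in> E. e \<subseteq> S - {v, w}}" by auto
    next
      fix f g assume "f \<in> M - {e}" "g \<in> M - {e}" "f \<noteq> g"
      then show "f \<inter> g = {}" by (intro pdM) auto
    qed
    moreover have "M = insert {v, w} (M - {e})" using e w by auto
    moreover have "w \<in> nbrs S v" using eE w by (auto simp: nbrs_def)
    ultimately show ?thesis by blast
  qed
next
  fix M assume "M \<in> ?A \<union> ?B"
  then show "M \<in> matchings S"
  proof
    assume "M \<in> ?A" then show ?thesis
      by (auto simp: matchings_def is_matching_def induced_E_def)
  next
    assume "M \<in> ?B"
    then obtain w M' where w: "w \<in> nbrs S v" and M': "M' \<in> matchings (S - {v, w})"
      and M: "M = insert {v, w} M'" by auto
    have disj: "f \<inter> {v, w} = {}" if "f \<in> M'" for f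
      using M' that matchings_subset by fastforce
    have pd: "f \<inter> g = {}" if "f \<in> M'" "g \<in> M'" "f \<noteq> g" for f g
      using M' that by (auto simp: matchings_def is_matching_def)
    have sub: "f \<in> E \<and> f \<subseteq> S" if "f \<in> M'" for f
      using M' that by (auto simp: matchings_def is_matching_def induced_E_def)
    show ?thesis
      unfolding matchings_def is_matching_def induced_E_def mem_Collect_eq M
    proof (intro conjI subsetI ballI impI)
      fix f assume "f \<in> insert {v, w} M'"
      then show "f \<in> {e \<in> E. e \<subseteq> S}" using sub w assms by (auto simp: nbrs_def)
    next
      fix f g assume "f \<in> insert {v, w} M'" "g \<in> insert {v, w} M'" "f \<noteq> g"
      then show "f \<inter> g = {}" using disj pd by (metis Int_commute insert_iff)
    qed
  qed
qed

text \<open>A matching missing \<open>v\<close> contributes a factor \<open>h v\<close>. One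
  containing the edge \<open>{v, w}\<close> is a matching of \<open>S - {v, w}\<close> plus that
  edge, which flips the sign.\<close>

lemma wm_rec:
  assumes "finite S" "v \<in> S"
  shows "wm h S = h v * wm h (S - {v}) - (\<Sum>w\<in>nbrs S v. wm h (S - {v, w}))"
proof -
  let ?t = "\<lambda>S M. (-1) ^ card M * (\<Prod>v\<in>S - \<Union>M. h v)"
  let ?B = "\<Union>w\<in>nbrs S v. insert {v, w} ` matchings (S - {v, w})"
  have notin: "v \<notin> \<Union>M" if "M \<in> matchings (S - {v})" for M
    using matchings_subset[OF that] by auto
  have fresh: "{v, w} \<notin> M" if "M \<in> matchings (S - {v, w})" for w M
    using matchings_subset[OF that] by auto
  have finB: "finite ?B"
    using assms(1) by (intro finite_UN_I finite_nbrs finite_imageI finite_matchings) auto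
  have disj: "matchings (S - {v}) \<inter> ?B = {}"
    using notin by blast
  have pw: "insert {v, w} ` matchings (S - {v, w}) \<inter> insert {v, w'} ` matchings (S - {v, w'}) = {}"
    if "w \<noteq> w'" for w w'
  proof -
    have False if "insert {v, w} M = insert {v, w'} M'" "M \<in> matchings (S - {v, w})"
      "M' \<in> matchings (S - {v, w'})" for M M'
    proof -
      have "{v, w} \<in> M'" using that(1) \<open>w \<noteq> w'\<close> by (metis doubleton_eq_iff insertCI insertE)
      then show False using matchings_subset[OF that(3)] by auto
    qed
    then show ?thesis by blast
  qed
  have inj: "inj_on (insert {v, w}) (matchings (S - {v, w}))" for w
    by (rule inj_onI) (metis fresh insert_ident)
  have 1: "(\<Sum>M\<in>matchings (S - {v}). ?t S M) = h v * wm h (S - {v})"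
    unfolding wm_def sum_distrib_left
  proof (rule sum.cong[OF refl])
    fix M assume M: "M \<in> matchings (S - {v})"
    have "S - \<Union>M = insert v (S - {v} - \<Union>M)" using notin[OF M] assms by auto
    then show "?t S M = h v * ?t (S - {v}) M" using assms by simp
  qed
  have 2: "(\<Sum>M\<in>insert {v, w} ` matchings (S - {v, w}). ?t S M) = - wm h (S - {v, w})" for w
    unfolding wm_def sum.reindex[OF inj] o_def sum_negf[symmetric]
  proof (rule sum.cong[OF refl])
    fix M assume M: "M \<in> matchings (S - {v, w})"
    have "card (insert {v, w} M) = Suc (card M)"
      using fresh[OF M] finite_matching[OF _ M] assms by simp
    moreover have "S - \<Union>(insert {v, w} M) = S - {v, w} - \<Union>M" by auto
    ultimately show "?t S (insert {v, w} M) = - ?t (S - {v, w}) M" by simp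
  qed
  have "wm h S = (\<Sum>M\<in>matchings (S - {v}). ?t S M) + (\<Sum>M\<in>?B. ?t S M)"
    unfolding wm_def matchings_split[OF assms(2)]
    using assms finB disj by (intro sum.union_disjoint) (auto intro: finite_matchings)
  also have "(\<Sum>M\<in>?B. ?t S M) = (\<Sum>w\<in>nbrs S v. \<Sum>M\<in>insert {v, w} ` matchings (S - {v, w}). ?t S M)"
    using assms pw by (intro sum.UNION_disjoint) (auto intro: finite_nbrs finite_matchings)
  finally show ?thesis unfolding 1 2 by (simp add: sum_negf)
qed

lemma card_Union_matching:
  assumes "finite S" "M \<in> matchings S"
  shows "card (\<Union>M) = 2 * card M"
proof -
  have "card (\<Union>M) = (\<Sum>e\<in>M. card e)"
  proof (rule card_Union_disjoint)
    show "pairwise disjnt M"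
      using assms(2) by (auto simp: matchings_def is_matching_def pairwise_def disjnt_def)
    show "finite e" if "e \<in> M" for e
      using matchings_subset[OF assms(2)] assms(1) that finite_subset by blast
  qed
  also have "\<dots> = (\<Sum>e\<in>M. 2)"
    using assms(2) by (intro sum.cong) (auto simp: matchings_def is_matching_def induced_E_def card_edge)
  finally show ?thesis by simp
qed

text \<open>A matching of size \<open>r\<close> leaves \<open>card S - 2 * r\<close> vertices
  uncovered, so grouping matchings by size gives the matching polynomial. This carries statements
  about \<open>wm\<close> over to \<open>mp\<close>.\<close>

lemma poly_mp:
  assumes "finite S"
  shows "poly (mp S) x = wm (\<lambda>_. x) S"
proof -
  have sub: "\<Union>M \<subseteq> S" if "M \<in> matchings S" for M using matchings_subset[OF that] by auto
  have le: "card M \<le> card S div 2" if "M \<in> matchings S" for M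
    using card_mono[OF assms sub[OF that]] card_Union_matching[OF assms that] by simp
  have "wm (\<lambda>_. x) S = (\<Sum>M\<in>matchings S. (-1) ^ card M * x ^ (card S - 2 * card M))"
    unfolding wm_def
  proof (rule sum.cong[OF refl])
    fix M assume M: "M \<in> matchings S"
    have "card (S - \<Union>M) = card S - 2 * card M"
      using card_Diff_subset[of "\<Union>M" S] sub[OF M] assms card_Union_matching[OF assms M] finite_subset
      by metis
    then show "(-1) ^ card M * (\<Prod>v\<in>S - \<Union>M. x) = (-1) ^ card M * x ^ (card S - 2 * card M)"
      by simp
  qed
  also have "\<dots> = (\<Sum>r\<le>card S div 2. \<Sum>M | M \<in> matchings S \<and> card M = r.
      (-1) ^ card M * x ^ (card S - 2 * card M))"
    using le assms by (intro sum.group[symmetric]) (auto intro: finite_matchings)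
  also have "\<dots> = (\<Sum>r\<le>card S div 2. (-1) ^ r * real (num_matchings (induced_E E S) r) * x ^ (card S - 2 * r))"
    by (intro sum.cong refl) (simp add: num_matchings_def matchings_def)
  also have "\<dots> = poly (mp S) x"
    by (simp add: mp_def match_poly_def poly_sum poly_monom)
  finally show ?thesis ..
qed

lemma mp_rec:
  assumes "finite S" "v \<in> S"
  shows "mp S = [:0, 1:] * mp (S - {v}) - (\<Sum>w\<in>nbrs S v. mp (S - {v, w}))"
proof -
  have "poly (mp S) = poly ([:0, 1:] * mp (S - {v}) - (\<Sum>w\<in>nbrs S v. mp (S - {v, w})))"
    using assms by (auto simp: fun_eq_iff poly_mp wm_rec[of S v] poly_sum)
  then show ?thesis by (simp add: poly_eq_poly_eq_iff)
qed

lemma mp_empty: "mp {} = 1"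
proof -
  have "induced_E E {} = {}"
    using card_edge[of "{}"] by (auto simp: induced_E_def)
  then have "matchings {} = {{}}" by (auto simp: matchings_def is_matching_def)
  then have "wm h {} = 1" for h by (simp add: wm_def)
  then have "poly (mp {}) = poly 1" by (simp only: fun_eq_iff poly_mp[OF finite.emptyI] poly_1 simp_thms)
  then show ?thesis by (simp only: poly_eq_poly_eq_iff)
qed

lemma mp_nonzero:
  assumes "finite S"
  shows "mp S \<noteq> 0"
proof -
  have "M = {}" if "is_matching (induced_E E S) M" "card M = 0" for M
    using finite_matching[OF assms, of M] that by (simp add: matchings_def)
  moreover have "is_matching (induced_E E S) {}" by (simp add: is_matching_def)
  ultimately have "{M. is_matching (induced_E E S) M \<and> card M = 0} = {{}}" by auto
  then have "num_matchings (induced_E E S) 0 = 1" unfolding num_matchings_def by simp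
  \<comment> \<open>Only the empty matching contributes to the top degree.\<close>
  moreover have "coeff (mp S) (card S) = (\<Sum>r\<le>card S div 2. if r = 0 then real (num_matchings (induced_E E S) 0) else 0)"
    unfolding mp_def match_poly_def coeff_sum
    by (intro sum.cong refl) auto
  ultimately have "coeff (mp S) (card S) = 1" by (simp add: sum.delta)
  then show ?thesis by auto
qed

text \<open>Differentiate the recurrence at a vertex \<open>u\<close> and apply the induction
  hypothesis to the smaller sets. After exchanging the two summations, the terms for each
  \<open>v\<close> form the recurrence at \<open>u\<close> in \<open>S - {v}\<close>.\<close>

lemma pderiv_mp:
  assumes "finite S"
  shows "pderiv (mp S) = (\<Sum>v\<in>S. mp (S - {v}))"
  using assms
proof (induction "card S" arbitrary: S rule: less_induct)
  case less
  show ?case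
  proof (cases "S = {}")
    case True then show ?thesis by (simp add: mp_empty)
  next
    case False
    then obtain u where u: "u \<in> S" by auto
    have fin: "finite S" by fact
    have IH: "pderiv (mp T) = (\<Sum>v\<in>T. mp (T - {v}))" if "T \<subset> S" for T
      using that less.hyps fin by (meson psubset_card_mono finite_subset psubset_imp_subset)
    let ?N = "nbrs S u"
    have N: "?N \<subseteq> S - {u}" "finite ?N" using fin by (auto simp: nbrs_def)
    have d2: "S - {u} - {v} = S - {u, v}" for v by auto
    have d3: "S - {u, w} - {v} = S - {u, w, v}" for v w by auto
    have "pderiv (mp S) = mp (S - {u}) + [:0,1:] * pderiv (mp (S - {u})) - (\<Sum>w\<in>?N. pderiv (mp (S - {u, w})))"
      unfolding mp_rec[OF fin u]
      by (simp add: pderiv_diff pderiv_mult higher_pderiv_sum[of 1, simplified] pderiv_pCons algebra_simps)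
    also have "pderiv (mp (S - {u})) = (\<Sum>v\<in>S - {u}. mp (S - {u, v}))"
    proof -
      have "S - {u} \<subset> S" using u by auto
      from IH[OF this] show ?thesis unfolding d2 .
    qed
    also have "(\<Sum>w\<in>?N. pderiv (mp (S - {u, w}))) = (\<Sum>w\<in>?N. \<Sum>v\<in>S - {u, w}. mp (S - {u, w, v}))"
    proof (intro sum.cong refl)
      fix w
      have "S - {u, w} \<subset> S" using u by auto
      from IH[OF this] show "pderiv (mp (S - {u, w})) = (\<Sum>v\<in>S - {u, w}. mp (S - {u, w, v}))"
        unfolding d3 .
    qed
    also have "\<dots> = (\<Sum>(w, v)\<in>Sigma ?N (\<lambda>w. S - {u, w}). mp (S - {u, w, v}))"
      using N fin by (intro sum.Sigma) auto
    \<comment> \<open>Both index sets consist of the pairs of a neighbour \<open>w\<close> of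
      \<open>u\<close> and a vertex \<open>v\<close> other than \<open>u\<close> and
      \<open>w\<close>.\<close>
    also have "\<dots> = (\<Sum>(v, w)\<in>Sigma (S - {u}) (\<lambda>v. ?N - {v}). mp (S - {u, w, v}))"
      by (rule sum.reindex_bij_witness[of _ prod.swap prod.swap]) (use N in auto)
    also have "\<dots> = (\<Sum>v\<in>S - {u}. \<Sum>w\<in>?N - {v}. mp (S - {u, w, v}))"
      using N fin by (intro sum.Sigma[symmetric]) auto
    finally have "pderiv (mp S) = mp (S - {u}) + (\<Sum>v\<in>S - {u}. [:0,1:] * mp (S - {u, v}) - (\<Sum>w\<in>?N - {v}. mp (S - {u, w, v})))"
      by (simp only: sum_subtractf sum_distrib_left add_diff_eq)
    also have "(\<Sum>v\<in>S - {u}. [:0,1:] * mp (S - {u, v}) - (\<Sum>w\<in>?N - {v}. mp (S - {u, w, v}))) = (\<Sum>v\<in>S - {u}. mp (S - {v}))"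
    proof (intro sum.cong refl)
      fix v assume v: "v \<in> S - {u}"
      have "nbrs (S - {v}) u = ?N - {v}" by (auto simp: nbrs_def)
      moreover have "S - {v} - {u} = S - {u, v}" by auto
      moreover have "S - {v} - {u, w} = S - {u, w, v}" for w by auto
      ultimately show "[:0,1:] * mp (S - {u, v}) - (\<Sum>w\<in>?N - {v}. mp (S - {u, w, v})) = mp (S - {v})"
        using mp_rec[of "S - {v}" u] fin u v not_sym[of v u] by simp
    qed
    finally show ?thesis using u fin by (simp add: sum.remove)
  qed
qed

text \<open>Induction on \<open>A\<close> with \<open>B\<close> fixed: the neighbours of a vertex of
  \<open>A\<close> all lie in \<open>A\<close>, so the recurrence at that vertex carries
  \<open>mp B\<close> along as a common factor.\<close>

lemma mp_Un:
  assumes "finite A" "finite B" "A \<inter> B = {}"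
    and "\<And>e. e \<in> E \<Longrightarrow> e \<subseteq> A \<union> B \<Longrightarrow> e \<subseteq> A \<or> e \<subseteq> B"
  shows "mp (A \<union> B) = mp A * mp B"
  using assms(1,3,4)
proof (induction "card A" arbitrary: A rule: less_induct)
  case less
  show ?case
  proof (cases "A = {}")
    case True then show ?thesis by (simp add: mp_empty)
  next
    case False
    then obtain u where u: "u \<in> A" by auto
    have IH: "mp (T \<union> B) = mp T * mp B" if "T \<subset> A" for T
    proof (rule less.hyps)
      show "card T < card A" using that less.prems(1) by (rule psubset_card_mono[rotated])
      show "finite T" using that less.prems(1) finite_subset by auto
      show "T \<inter> B = {}" using that less.prems(2) by auto
      show "e \<subseteq> T \<or> e \<subseteq> B" if "e \<in> E" "e \<subseteq> T \<union> B" for e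
      proof (cases "e \<subseteq> B")
        case False
        from that \<open>T \<subset> A\<close> have "e \<subseteq> A \<union> B" by auto
        from less.prems(3)[OF that(1) this] False have "e \<subseteq> A" by simp
        with that(2) less.prems(2) show ?thesis by auto
      qed simp
    qed
    have uB: "u \<notin> B" using u less.prems(2) by auto
    have "w \<in> A" if "{u, w} \<in> E" "w \<in> B" for w
      using less.prems(3)[OF that(1)] that(2) u uB by simp
    then have nb: "nbrs (A \<union> B) u = nbrs A u"
      by (auto simp: nbrs_def)
    have "(A \<union> B) - {u} = (A - {u}) \<union> B" using uB by auto
    moreover have "(A \<union> B) - {u, w} = (A - {u, w}) \<union> B" if "w \<in> nbrs A u" for w
      using that uB less.prems(2) by (auto simp: nbrs_def)
    moreover have "A - {u} \<subset> A" "A - {u, w} \<subset> A" for w using u by auto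
    ultimately have "mp (A \<union> B) = [:0, 1:] * (mp (A - {u}) * mp B)
        - (\<Sum>w\<in>nbrs A u. mp (A - {u, w}) * mp B)"
      using mp_rec[of "A \<union> B" u] u less.prems(1) assms(2) IH nb
      by (simp cong: sum.cong)
    also have "\<dots> = mp A * mp B"
      unfolding mp_rec[OF less.prems(1) u] by (simp only: left_diff_distrib sum_distrib_right mult.assoc)
    finally show ?thesis .
  qed
qed

section \<open>The Heilmann--Lieb inequality\<close>

text \<open>Expand \<open>wm h S\<close> and \<open>wm h (S - {v})\<close> at \<open>u\<close>. The
  terms with \<open>h u\<close> cancel, the edge \<open>{u, v}\<close> yields the square, and every
  other neighbour \<open>w\<close> of \<open>u\<close> yields the same expression for the pair
  \<open>w\<close>, \<open>v\<close> in \<open>S - {u}\<close>, nonnegative by induction.\<close>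

lemma rayleigh:
  assumes "finite S" "u \<in> S" "v \<in> S" "u \<noteq> v"
  shows "wm h (S - {u}) * wm h (S - {v}) - wm h S * wm h (S - {u, v})
    \<ge> (if {u, v} \<in> E then (wm h (S - {u, v}))\<^sup>2 else 0)"
  using assms
proof (induction "card S" arbitrary: S u)
  case 0 then show ?case by auto
next
  case (Suc n)
  let ?N = "nbrs S u"
  have finN: "finite ?N" using Suc by (simp add: finite_nbrs)
  have nb: "nbrs (S - {v}) u = ?N - {v}" by (auto simp: nbrs_def)
  have s1: "S - {v} - {u} = S - {u, v}" by auto
  have s2: "S - {v} - {u, w} = S - {u, v, w}" for w by auto
  have r1: "wm h S = h u * wm h (S - {u}) - (\<Sum>w\<in>?N. wm h (S - {u, w}))"
    using Suc.prems by (intro wm_rec)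
  have r2: "wm h (S - {v}) = h u * wm h (S - {u, v}) - (\<Sum>w\<in>?N - {v}. wm h (S - {u, v, w}))"
    using wm_rec[of "S - {v}" u h] Suc.prems unfolding nb s1 s2 by auto
  have split: "(\<Sum>w\<in>?N. wm h (S - {u, w})) = (if {u, v} \<in> E then wm h (S - {u, v}) else 0) + (\<Sum>w\<in>?N - {v}. wm h (S - {u, w}))"
  proof (cases "v \<in> ?N")
    case True then show ?thesis using finN by (auto simp: sum.remove nbrs_def)
  next
    case False
    then have "?N - {v} = ?N" "{u, v} \<notin> E" using Suc.prems by (auto simp: nbrs_def)
    then show ?thesis by simp
  qed
  have "(\<Sum>w\<in>?N - {v}. wm h (S - {u, w}) * wm h (S - {u, v}) - wm h (S - {u}) * wm h (S - {u, v, w})) \<ge> 0"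
  proof (rule sum_nonneg)
    fix w assume w: "w \<in> ?N - {v}"
    have "S - {u} - {w} = S - {u, w}" "S - {u} - {v} = S - {u, v}" "S - {u} - {w, v} = S - {u, v, w}"
      by auto
    moreover have "n = card (S - {u})" using Suc by simp
    ultimately show "wm h (S - {u, w}) * wm h (S - {u, v}) - wm h (S - {u}) * wm h (S - {u, v, w}) \<ge> 0"
      using order_trans[OF _ Suc.hyps(1)[of "S - {u}" w], of 0] Suc.prems w
      by (simp add: nbrs_def)
  qed
  also have "\<dots> = wm h (S - {u}) * wm h (S - {v}) - wm h S * wm h (S - {u, v}) - (if {u, v} \<in> E then (wm h (S - {u, v}))\<^sup>2 else 0)"
    unfolding r1 split unfolding r2
    by (auto simp: algebra_simps sum_subtractf sum_distrib_left sum_distrib_right power2_eq_square)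
  finally show ?case by simp
qed

lemma dvd_mp_iff: "finite S \<Longrightarrow> [:-\<theta>, 1:] ^ n dvd mp S \<longleftrightarrow> n \<le> m S"
  unfolding m_def using mp_nonzero by (simp add: order_divides)

lemma poly_rayleigh:
  assumes "finite S" "u \<in> S" "v \<in> S" "u \<noteq> v"
  shows "poly (mp (S - {u}) * mp (S - {v}) - mp S * mp (S - {u, v})) x
    \<ge> (if {u, v} \<in> E then (poly (mp (S - {u, v})) x)\<^sup>2 else 0)"
  using rayleigh[OF assms, of "\<lambda>_. x"] assms(1)
  by (simp only: poly_diff poly_mult poly_mp finite_Diff)

section \<open>Interlacing and essential vertices\<close>

lemma m_le_m_delete:
  assumes fin: "finite S" and u: "u \<in> S"
  shows "m S \<le> m (S - {u}) + 1"
proof (rule ccontr)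
  define a where "a = m (S - {u})"
  let ?L = "[:-\<theta>, 1:]"
  \<comment> \<open>Since \<open>\<mu>'(G)\<close> is the sum of the \<open>\<mu>(G - v)\<close>, summing the Heilmann--Lieb inequality over
    \<open>v\<close> bounds this Wronskian below by \<open>\<mu>(G - u)\<^sup>2\<close>.\<close>
  let ?p = "mp (S - {u}) * pderiv (mp S) - mp S * pderiv (mp (S - {u}))"
  assume "\<not> ?thesis"
  then have gt: "m S \<ge> a + 2" unfolding a_def by simp
  have d2: "S - {u} - {v} = S - {u, v}" for v by auto
  have "?p = mp (S - {u}) * (\<Sum>v\<in>S. mp (S - {v})) - mp S * (\<Sum>v\<in>S - {u}. mp (S - {u, v}))"
    using fin by (simp only: pderiv_mp finite_Diff d2)
  also have "\<dots> = (mp (S - {u}))\<^sup>2 +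
      (\<Sum>v\<in>S - {u}. mp (S - {u}) * mp (S - {v}) - mp S * mp (S - {u, v}))"
    using fin u by (simp add: sum.remove[of S u] algebra_simps sum_subtractf sum_distrib_left power2_eq_square)
  finally have p: "?p = \<dots>" .
  have "poly ?p x \<ge> (poly (mp (S - {u})) x)\<^sup>2" for x
  proof -
    have "(\<Sum>v\<in>S - {u}. poly (mp (S - {u}) * mp (S - {v}) - mp S * mp (S - {u, v})) x) \<ge> 0"
    proof (rule sum_nonneg)
      fix v assume "v \<in> S - {u}"
      then have "u \<noteq> v" "v \<in> S" by auto
      from poly_rayleigh[OF fin u this(2,1), of x]
      show "poly (mp (S - {u}) * mp (S - {v}) - mp S * mp (S - {u, v})) x \<ge> 0"
        by (rule order_trans[rotated]) simp
    qed
    then show ?thesis unfolding p poly_add poly_sum by simp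
  qed
  from order_ge_square(1)[OF this] order_ge_square(2)[OF this, of \<theta>] mp_nonzero fin
  have p0: "?p \<noteq> 0" and le: "order \<theta> ?p \<le> 2 * a" by (auto simp: a_def m_def)
  \<comment> \<open>Both products in the Wronskian now turn out to vanish to order at least
    \<open>2 * a + 1\<close>, against the bound \<open>2 * a\<close> just obtained.\<close>
  have 1: "?L ^ a dvd mp (S - {u})" "?L ^ (a + 2) dvd mp S"
    using fin gt by (auto simp only: dvd_mp_iff finite_Diff a_def)
  have "?L ^ (a + 1) dvd pderiv (mp S)" using 1(2) by (intro power_dvd_pderiv) simp
  with 1(1) have "?L ^ (a + (a + 1)) dvd mp (S - {u}) * pderiv (mp S)"
    unfolding power_add[of _ a "a + 1"] by (rule mult_dvd_mono)
  moreover have "?L ^ (a + (a + 1)) dvd mp S * pderiv (mp (S - {u}))"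
  proof (cases a)
    \<comment> \<open>Differentiating \<open>mp (S - {u})\<close> leaves no guaranteed factor here,
      but the two factors of \<open>mp S\<close> already suffice.\<close>
    case 0
    have "?L ^ (a + (a + 1)) dvd ?L ^ (a + 2)" using 0 by (intro le_imp_power_dvd) simp
    then show ?thesis using 1(2) dvd_mult2 dvd_trans by blast
  next
    case (Suc b)
    have "?L ^ b dvd pderiv (mp (S - {u}))" using 1(1) Suc by (intro power_dvd_pderiv) simp
    with 1(2) have "?L ^ ((a + 2) + b) dvd mp S * pderiv (mp (S - {u}))"
      unfolding power_add[of _ "a + 2" b] by (rule mult_dvd_mono)
    then show ?thesis using Suc by (simp del: power_Suc)
  qed
  ultimately have "?L ^ (a + (a + 1)) dvd ?p" by (rule dvd_diff)
  then have "a + (a + 1) \<le> order \<theta> ?p" using p0 order_divides by blast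
  with le show False by simp
qed

text \<open>By the other half of interlacing, deleting a further vertex \<open>w\<close> from
  \<open>S - {u}\<close> loses at most one, so all terms of the recurrence at \<open>u\<close> share
  the power \<open>b\<close>.\<close>

lemma m_delete_le:
  assumes fin: "finite S" and u: "u \<in> S"
  shows "m (S - {u}) \<le> m S + 1"
proof -
  \<comment> \<open>The subtraction is truncated; if \<open>m (S - {u})\<close> is zero, the bound
    holds trivially.\<close>
  define b where "b = m (S - {u}) - 1"
  let ?L = "[:-\<theta>, 1:]"
  have "?L ^ b dvd mp (S - {u})" using fin by (simp only: dvd_mp_iff finite_Diff b_def diff_le_self)
  moreover have "?L ^ b dvd mp (S - {u, w})" if "w \<in> nbrs S u" for w
  proof -
    have "S - {u} - {w} = S - {u, w}" by auto
    then have "b \<le> m (S - {u, w})"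
      using m_le_m_delete[of "S - {u}" w] that fin by (simp add: nbrs_def b_def)
    then show ?thesis using fin by (simp only: dvd_mp_iff finite_Diff)
  qed
  ultimately have "?L ^ b dvd mp S"
    unfolding mp_rec[OF fin u] by (intro dvd_diff dvd_sum dvd_mult) auto
  then show ?thesis using fin by (simp only: dvd_mp_iff) (simp add: b_def)
qed

text \<open>Differentiation lowers a positive order by exactly one. If no deletion lowered the
  multiplicity, the derivative, being the sum of the \<open>mp (S - {u})\<close>, would keep the
  full order.\<close>

lemma exists_essential:
  assumes fin: "finite S" and pos: "m S > 0"
  shows "\<exists>u\<in>S. m (S - {u}) + 1 = m S"
proof (rule ccontr)
  assume contra: "\<not> ?thesis"
  let ?L = "[:-\<theta>, 1:]"
  have ge: "m (S - {u}) \<ge> m S" if "u \<in> S" for u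
    using m_le_m_delete[OF fin that] contra that by (metis add.commute le_antisym not_less_eq_eq plus_1_eq_Suc)
  have dvd: "?L ^ m S dvd pderiv (mp S)"
    unfolding pderiv_mp[OF fin] using ge fin by (intro dvd_sum) (simp only: dvd_mp_iff finite_Diff)
  have "pderiv (mp S) \<noteq> 0"
  proof
    assume "pderiv (mp S) = 0"
    then obtain c where "mp S = [:c:]" using pderiv_iszero by blast
    with mp_nonzero[OF fin] have "m S = 0" by (auto simp: m_def intro!: order_0I)
    with pos show False by simp
  qed
  moreover have "m S = Suc (order \<theta> (pderiv (mp S)))"
    using pos mp_nonzero[OF fin] order_root[of "mp S" \<theta>] unfolding m_def by (intro order_pderiv) auto
  moreover have "m S \<le> order \<theta> (pderiv (mp S))" using calculation(1) dvd order_divides by blast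
  ultimately show False by simp
qed

text \<open>If deleting \<open>u\<close> kept the multiplicity, the nonnegative polynomial \<open>D\<close> below would vanish to
  odd order, or to an order exceeding that of \<open>\<mu>(G - u - v)\<^sup>2\<close>.\<close>

lemma special_positive:
  assumes fin: "finite S" and uv: "u \<in> S" "v \<in> S" "u \<noteq> v" "{u, v} \<in> E"
    and v: "m (S - {v}) + 1 = m S" and u: "m (S - {u}) \<ge> m S"
  shows "m (S - {u}) = m S + 1"
proof (rule ccontr)
  assume "\<not> ?thesis"
  with u m_delete_le[OF fin uv(1)] have u: "m (S - {u}) = m S" by simp
  let ?L = "[:-\<theta>, 1:]"
  define a where "a = m (S - {v})"
  define D where "D = mp (S - {u}) * mp (S - {v}) - mp S * mp (S - {u, v})"
  have ge: "poly D x \<ge> (poly (mp (S - {u, v})) x)\<^sup>2" for x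
    using poly_rayleigh[OF fin uv(1-3), of x] uv(4) by (simp add: D_def)
  have D0: "D \<noteq> 0" and le: "order \<theta> D \<le> 2 * m (S - {u, v})"
    using order_ge_square(1)[OF ge] order_ge_square(2)[OF ge, of \<theta>] mp_nonzero fin by (auto simp: m_def)
  have ev: "even (order \<theta> D)"
    using order_nonneg_even[OF _ D0] ge order_trans[OF zero_le_power2] by blast
  have "S - {u} - {v} = S - {u, v}" by auto
  with m_le_m_delete[of "S - {u}" v] have uv_ge: "m (S - {u, v}) \<ge> a"
    using fin uv u v by (simp add: a_def)
  have "mp (S - {u}) * mp (S - {v}) \<noteq> 0" using fin mp_nonzero by simp
  moreover from this have "order \<theta> (mp (S - {u}) * mp (S - {v})) = 2 * a + 1"
    using u v by (simp add: order_mult a_def flip: m_def)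
  ultimately obtain q where q: "mp (S - {u}) * mp (S - {v}) = ?L ^ (2 * a + 1) * q" "\<not> ?L dvd q"
    by (metis order_decomp)
  have dvd: "?L ^ (m S + m (S - {u, v})) dvd mp S * mp (S - {u, v})"
    unfolding power_add using fin by (intro mult_dvd_mono) (simp_all only: dvd_mp_iff finite_Diff order_refl)
  show False
  proof (cases "m (S - {u, v}) = a")
    case True
    have "m S + m (S - {u, v}) = 2 * a + 1" using True v by (simp add: a_def)
    with dvd have "?L ^ (2 * a + 1) dvd D"
      unfolding D_def q(1) by (intro dvd_diff) simp_all
    then have "2 * a + 1 \<le> order \<theta> D" using D0 order_divides by blast
    with le True show False by simp
  next
    \<comment> \<open>The subtracted product vanishes to order at least \<open>2 * a + 2\<close>, so
      \<open>D\<close> inherits the odd order \<open>2 * a + 1\<close> of the first product.\<close>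
    case False
    with uv_ge have "?L ^ (2 * a + 2) dvd ?L ^ (m S + m (S - {u, v}))"
      using v by (intro le_imp_power_dvd) (simp add: a_def)
    with dvd obtain r where r: "mp S * mp (S - {u, v}) = ?L ^ (2 * a + 2) * r"
      by (meson dvdE dvd_trans)
    have "D = ?L ^ (2 * a + 1) * (q - ?L * r)"
      unfolding D_def q(1) r by (simp only: power_add algebra_simps power_one_right power2_eq_square)
    moreover have "\<not> ?L dvd q - ?L * r" using q(2) by (metis dvd_diff_left_iff dvd_triv_left)
    moreover have "?L ^ (2 * a + 1) \<noteq> 0" by (simp del: power_Suc)
    ultimately have "?L ^ (2 * a + 1) dvd D" "\<not> ?L ^ Suc (2 * a + 1) dvd D"
      unfolding power_Suc2[of _ "2 * a + 1"]
      by (simp_all only: dvd_triv_left dvd_mult_cancel_left simp_thms)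
    then have "order \<theta> D = 2 * a + 1" by (rule order_unique_lemma)
    with ev show False by simp
  qed
qed

text \<open>Otherwise interlacing forces \<open>m S = b + 2\<close>, and both products in
  \<open>D\<close> vanish to order at least \<open>2 * b + 2\<close>. Since \<open>D\<close>
  dominates the square of \<open>mp (S - {u, v})\<close>, its order is at most
  \<open>2 * b\<close>.\<close>

lemma adjacent_essential:
  assumes fin: "finite S" and uv: "u \<in> S" "v \<in> S" "u \<noteq> v" "{u, v} \<in> E"
    and u: "m (S - {u}) + 1 = m S" and v: "m (S - {v}) + 1 = m S"
  shows "m S \<le> m (S - {u, v}) + 1"
proof (rule ccontr)
  assume "\<not> ?thesis"
  let ?L = "[:-\<theta>, 1:]"
  define D where "D = mp (S - {u}) * mp (S - {v}) - mp S * mp (S - {u, v})"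
  define b where "b = m (S - {u, v})"
  have ge: "poly D x \<ge> (poly (mp (S - {u, v})) x)\<^sup>2" for x
    using poly_rayleigh[OF fin uv(1-3), of x] uv(4) by (simp add: D_def)
  have D0: "D \<noteq> 0" and le: "order \<theta> D \<le> 2 * b"
    using order_ge_square(1)[OF ge] order_ge_square(2)[OF ge, of \<theta>] mp_nonzero fin by (auto simp: m_def b_def)
  have "S - {u} - {v} = S - {u, v}" by auto
  with m_le_m_delete[of "S - {u}" v] \<open>\<not> ?thesis\<close> have eq: "m S = b + 2"
    using fin uv u v by (simp add: b_def)
  have "?L ^ ((b + 1) + (b + 1)) dvd mp (S - {u}) * mp (S - {v})"
    unfolding power_add[of _ "b + 1" "b + 1"] using fin eq u v
    by (intro mult_dvd_mono) (simp_all add: dvd_mp_iff del: power_Suc)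
  moreover have "?L ^ ((b + 2) + b) dvd mp S * mp (S - {u, v})"
    unfolding power_add[of _ "b + 2" b] using fin eq b_def
    by (intro mult_dvd_mono) (simp_all add: dvd_mp_iff del: power_Suc)
  ultimately have "?L ^ (2 * b + 2) dvd D"
    unfolding D_def by (intro dvd_diff) (simp_all add: mult_2 del: power_Suc)
  then have "2 * b + 2 \<le> order \<theta> D" using D0 order_divides by blast
  with le show False by simp
qed

section \<open>Gallai's lemma\<close>

lemma wm_cong: "(\<And>v. v \<in> S \<Longrightarrow> h v = h' v) \<Longrightarrow> wm h S = wm h' S"
  unfolding wm_def by (intro sum.cong refl arg_cong2[of _ _ _ _ "(*)"] prod.cong) auto

text \<open>By the recurrence at \<open>w\<close>, the weighted sum is affine in the weight of
  \<open>w\<close>, with slope given by \<open>S - {w}\<close>.\<close>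

lemma wm_upd:
  assumes "finite S" "w \<in> S"
  shows "wm ((\<lambda>_. x)(w := x + s)) S = poly (mp S) x + s * poly (mp (S - {w})) x"
proof -
  have "wm ((\<lambda>_. x)(w := x + s)) T = poly (mp T) x" if "w \<notin> T" "finite T" for T
    unfolding poly_mp[OF that(2)] using that(1) by (intro wm_cong) auto
  then show ?thesis
    using wm_rec[OF assms, of "(\<lambda>_. x)(w := x + s)"] wm_rec[OF assms, of "\<lambda>_. x"] assms
    by (simp add: poly_mp algebra_simps)
qed

lemma mp_factor:
  assumes "finite S" "n \<le> m S"
  obtains q where "\<And>x. poly (mp S) x = (x - \<theta>) ^ n * poly q x"
proof -
  obtain q where "mp S = [:-\<theta>, 1:] ^ n * q" using assms dvd_mp_iff by (metis dvdE)
  then show ?thesis by (intro that[of q]) simp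
qed

lemma mp_factor_exact:
  assumes "finite S" "n = m S"
  obtains q where "\<And>x. poly (mp S) x = (x - \<theta>) ^ n * poly q x" "poly q \<theta> \<noteq> 0"
proof -
  obtain q where "mp S = [:-\<theta>, 1:] ^ n * q" "\<not> [:-\<theta>, 1:] dvd q"
    using order_decomp[OF mp_nonzero] assms m_def by metis
  then show ?thesis by (intro that[of q]) (simp_all add: poly_eq_0_iff_dvd)
qed

text \<open>Perturb the weight of \<open>w\<close> by \<open>t (x - \<theta>)\<close>. If \<open>u\<close> and \<open>w\<close> were not parallel, the leading
  coefficient at \<open>\<theta>\<close> of the Heilmann--Lieb expression for \<open>u\<close>, \<open>v\<close> would be a nonconstant affine
  function of \<open>t\<close>, which cannot be nonnegative for all real \<open>t\<close>.\<close>

lemma parallel_trans: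
  assumes fin: "finite S" and in_S: "u \<in> S" "v \<in> S" "w \<in> S"
    and distinct: "u \<noteq> v" "v \<noteq> w" "u \<noteq> w"
    and u: "m (S - {u}) + 1 = m S" and v: "m (S - {v}) + 1 = m S"
    and uv: "m S \<le> m (S - {u, v}) + 1" and vw: "m S \<le> m (S - {v, w}) + 1"
  shows "m S \<le> m (S - {u, w}) + 1"
proof (rule ccontr)
  assume "\<not> ?thesis"
  define n where "n = m (S - {u, w})"
  have "S - {u} - {w} = S - {u, w}" by auto
  with m_le_m_delete[of "S - {u}" w] have "m (S - {u}) \<le> n + 1"
    using fin in_S distinct by (simp add: n_def)
  with \<open>\<not> ?thesis\<close> u have k: "m S = n + 2" by (simp add: n_def)
  have "S - {u, v} - {w} = S - {u, v, w}" by auto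
  with m_le_m_delete[of "S - {u, v}" w] have uvw: "n \<le> m (S - {u, v, w})"
    using fin in_S distinct uv k by simp
  have w: "n + 1 \<le> m (S - {w})" using m_le_m_delete[OF fin in_S(3)] k by simp
  have fin': "finite (S - T)" for T using fin by simp
  \<comment> \<open>Cofactors after removing the known powers of \<open>x - \<theta>\<close>. The
    exact multiplicities of \<open>S - {v}\<close> and \<open>S - {u, w}\<close> make
    \<open>B\<close> and \<open>C\<close> nonzero at \<open>\<theta>\<close>.\<close>
  obtain A where A: "\<And>x. poly (mp (S - {u})) x = (x - \<theta>) ^ (n + 1) * poly A x"
    using mp_factor[OF fin', of "n + 1" "{u}"] u k by auto
  obtain B where B: "\<And>x. poly (mp (S - {v})) x = (x - \<theta>) ^ (n + 1) * poly B x" "poly B \<theta> \<noteq> 0"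
    using mp_factor_exact[OF fin', of "n + 1" "{v}"] v k by auto
  obtain C where C: "\<And>x. poly (mp (S - {u, w})) x = (x - \<theta>) ^ n * poly C x" "poly C \<theta> \<noteq> 0"
    using mp_factor_exact[OF fin', of n "{u, w}"] by (auto simp: n_def)
  obtain D where D: "\<And>x. poly (mp (S - {v, w})) x = (x - \<theta>) ^ (n + 1) * poly D x"
    using mp_factor[OF fin', of "n + 1" "{v, w}"] vw k by auto
  obtain G where G: "\<And>x. poly (mp S) x = (x - \<theta>) ^ (n + 2) * poly G x"
    using mp_factor[OF fin, of "n + 2"] k by auto
  obtain W where W: "\<And>x. poly (mp (S - {w})) x = (x - \<theta>) ^ (n + 1) * poly W x"
    using mp_factor[OF fin', of "n + 1" "{w}"] w by auto
  obtain U where U: "\<And>x. poly (mp (S - {u, v})) x = (x - \<theta>) ^ (n + 1) * poly U x"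
    using mp_factor[OF fin', of "n + 1" "{u, v}"] uv k by auto
  obtain Z where Z: "\<And>x. poly (mp (S - {u, v, w})) x = (x - \<theta>) ^ n * poly Z x"
    using mp_factor[OF fin', of n "{u, v, w}"] uvw by auto
  have nonneg: "(poly A \<theta> + t * poly C \<theta>) * poly B \<theta> \<ge> 0" for t
  proof -
    \<comment> \<open>The perturbed inequality divided by
      \<open>(x - \<theta>) ^ (2 * n + 2)\<close>. At \<open>\<theta>\<close> only the product of
      \<open>A + t C\<close> and \<open>B\<close> survives.\<close>
    let ?R = "(A + [:t:] * C) * (B + [:t:] * [:-\<theta>, 1:] * D) - [:-\<theta>, 1:] * (G + [:t:] * W) * (U + [:t:] * Z)"
    have "poly ?R x \<ge> 0" if "x \<noteq> \<theta>" for x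
    proof -
      define y where "y = x - \<theta>"
      define h where "h = (\<lambda>_. x)(w := x + t * y)"
      have d: "S - {u} - {w} = S - {u, w}" "S - {v} - {w} = S - {v, w}" "S - {u, v} - {w} = S - {u, v, w}"
        by auto
      have "wm h (S - {u}) * wm h (S - {v}) - wm h S * wm h (S - {u, v}) \<ge> 0"
        using rayleigh[OF fin in_S(1,2) distinct(1), of h] by (rule order_trans[rotated]) simp
      also have "wm h (S - {u}) = y ^ (n + 1) * (poly A x + t * poly C x)"
        unfolding h_def using fin in_S distinct
        by (subst wm_upd) (auto simp: d A C y_def algebra_simps)
      also have "wm h (S - {v}) = y ^ (n + 1) * (poly B x + t * y * poly D x)"
        unfolding h_def using fin in_S distinct
        by (subst wm_upd) (auto simp: d B D y_def algebra_simps)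
      also have "wm h S = y ^ (n + 2) * (poly G x + t * poly W x)"
        unfolding h_def using fin in_S
        by (subst wm_upd) (auto simp: G W y_def algebra_simps)
      also have "wm h (S - {u, v}) = y ^ (n + 1) * (poly U x + t * poly Z x)"
        unfolding h_def using fin in_S distinct
        by (subst wm_upd) (auto simp: d U Z y_def algebra_simps)
      finally have "(y ^ (n + 1))\<^sup>2 * ((poly A x + t * poly C x) * (poly B x + t * y * poly D x) -
          y * (poly G x + t * poly W x) * (poly U x + t * poly Z x)) \<ge> 0"
        by (simp add: algebra_simps power2_eq_square)
      moreover have "(y ^ (n + 1))\<^sup>2 > 0" using that by (simp add: y_def)
      ultimately have "(poly A x + t * poly C x) * (poly B x + t * y * poly D x) -
          y * (poly G x + t * poly W x) * (poly U x + t * poly Z x) \<ge> 0"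
        by (rule zero_le_mult_imp_nonneg[rotated])
      then show ?thesis by (simp add: y_def algebra_simps)
    qed
    then have "poly ?R \<theta> \<ge> 0" by (rule poly_nonneg_limit)
    then show ?thesis by simp
  qed
  \<comment> \<open>This \<open>t\<close> turns the first factor into
    \<open>- poly B \<theta>\<close>.\<close>
  have "(poly A \<theta> + (- (poly A \<theta> + poly B \<theta>) / poly C \<theta>) * poly C \<theta>) * poly B \<theta> = - (poly B \<theta>)\<^sup>2"
    using C(2) by (simp add: power2_eq_square)
  also have "\<dots> < 0" using B(2) by simp
  finally show False using nonneg by (meson not_le)
qed

lemma reach_edge:
  assumes "{v, w} \<in> induced_E E S"
  shows "{v, w} \<in> E" "v \<in> S" "w \<in> S" "v \<noteq> w"
  using assms card_edge[of "{v, w}"] by (auto simp: induced_E_def)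

text \<open>Fix \<open>u\<close>. Parallelism with \<open>u\<close> spreads along walks, hence to
  every other vertex. Were \<open>m (S - {u})\<close> positive, an essential vertex of
  \<open>S - {u}\<close> would lower the multiplicity a second time and so fail to be parallel to
  \<open>u\<close>.\<close>

lemma gallai:
  assumes fin: "finite S" and conn: "connected_graph S (induced_E E S)"
    and ess: "\<And>u. u \<in> S \<Longrightarrow> m (S - {u}) + 1 = m S"
  shows "m S = 1"
proof -
  from conn obtain u where u: "u \<in> S" by (auto simp: connected_graph_def)
  have "v \<in> S \<and> (v \<noteq> u \<longrightarrow> m S \<le> m (S - {u, v}) + 1)" if "reach (induced_E E S) u v" for v
    using that unfolding reach_def
  proof (induction rule: rtranclp_induct)
    case base then show ?case using u by simp
  next
    case (step v w)
    note e = reach_edge[OF step(2)]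
    have vw: "m S \<le> m (S - {v, w}) + 1"
      using adjacent_essential[OF fin e(2,3,4,1) ess[OF e(2)] ess[OF e(3)]] .
    show ?case
    \<comment> \<open>Transitivity requires three distinct vertices; when they are not distinct, the
      edge \<open>{v, w}\<close> itself settles the claim.\<close>
    proof (cases "w = u \<or> v = u")
      case True then show ?thesis using e vw by auto
    next
      case False
      then show ?thesis
        using parallel_trans[OF fin u e(2,3) _ e(4) _ ess[OF u] ess[OF e(2)] _ vw] step.IH e by blast
    qed
  qed
  then have par: "m S \<le> m (S - {u, v}) + 1" if "v \<in> S" "v \<noteq> u" for v
    using conn u that by (auto simp: connected_graph_def)
  have "m (S - {u}) = 0"
  proof (rule ccontr)
    assume "m (S - {u}) \<noteq> 0"
    then obtain v where v: "v \<in> S - {u}" "m (S - {u} - {v}) + 1 = m (S - {u})"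
      using exists_essential[of "S - {u}"] fin by auto
    moreover have "S - {u} - {v} = S - {u, v}" by auto
    ultimately show False using par[of v] ess[OF u] by simp
  qed
  then show ?thesis using ess[OF u] by simp
qed

text \<open>Some vertex is essential because the multiplicity is positive. By
  \<open>special_positive\<close> a non-essential neighbour of an essential vertex would raise the
  multiplicity, so essentiality spreads along walks.\<close>

lemma all_essential_if_no_positive:
  assumes fin: "finite S" and conn: "connected_graph S (induced_E E S)"
    and np: "\<And>u. u \<in> S \<Longrightarrow> m (S - {u}) \<noteq> m S + 1" and pos: "m S > 0" and v: "v \<in> S"
  shows "m (S - {v}) + 1 = m S"
proof -
  obtain u where u: "u \<in> S" "m (S - {u}) + 1 = m S" using exists_essential[OF fin pos] by auto
  have "reach (induced_E E S) u v" using conn u v by (auto simp: connected_graph_def)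
  then show ?thesis unfolding reach_def
  proof (induction rule: rtranclp_induct)
    case base show ?case by (rule u)
  next
    case (step v w)
    note e = reach_edge[OF step(2)]
    have "{w, v} \<in> E" using e(1) by (simp add: insert_commute)
    then have "\<not> m S \<le> m (S - {w})"
      using special_positive[OF fin e(3,2) e(4)[symmetric] _ step.IH] np[OF e(3)] by blast
    then show ?case using m_le_m_delete[OF fin e(3)] by simp
  qed
qed

section \<open>Additivity of the multiplicity over connected components\<close>

abbreviation comps :: "'a set \<Rightarrow> 'a set set" where
  "comps S \<equiv> components S (induced_E E S)"

lemma comps_subset: "C \<in> comps S \<Longrightarrow> C \<subseteq> S"
  by (auto simp: components_def)

lemma connected_comps:
  assumes "C \<in> comps S"
  shows "connected_graph C (induced_E E C)"
proof -
  have "connected_graph C (induced_E (induced_E E S) C)"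
    using assms by (rule connected_component) (simp add: induced_E_def)
  then show ?thesis by (simp only: induced_E_induced_E[OF comps_subset[OF assms]])
qed

lemma finite_comps: "finite S \<Longrightarrow> finite (comps S)"
  by (rule finite_subset[of _ "Pow S"]) (use comps_subset in auto)

lemma edge_within_comps:
  assumes "e \<in> E" "e \<subseteq> S"
  shows "\<exists>C\<in>comps S. e \<subseteq> C"
proof -
  obtain v w where "e = {v, w}" using card_edge[OF assms(1)] by (auto simp: card_2_iff)
  then show ?thesis using assms edge_within_component[of v w "induced_E E S" S]
    by (auto simp: induced_E_def)
qed

lemma m_Un:
  assumes "finite A" "finite B" "A \<inter> B = {}"
    and "\<And>e. e \<in> E \<Longrightarrow> e \<subseteq> A \<union> B \<Longrightarrow> e \<subseteq> A \<or> e \<subseteq> B"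
  shows "m (A \<union> B) = m A + m B"
proof -
  have "mp (A \<union> B) = mp A * mp B" using assms by (rule mp_Un)
  then show ?thesis using mp_nonzero assms(1,2) by (simp add: m_def order_mult)
qed

lemma m_Union:
  assumes "finite F" "\<And>C. C \<in> F \<Longrightarrow> finite C"
    and "\<And>C D. C \<in> F \<Longrightarrow> D \<in> F \<Longrightarrow> C \<noteq> D \<Longrightarrow> C \<inter> D = {}"
    and "\<And>e. e \<in> E \<Longrightarrow> e \<subseteq> \<Union>F \<Longrightarrow> \<exists>C\<in>F. e \<subseteq> C"
  shows "m (\<Union>F) = (\<Sum>C\<in>F. m C)"
  using assms
proof (induction F rule: finite_induct)
  case empty
  then show ?case by (simp add: m_def mp_empty)
next
  case (insert C F)
  have disj: "C \<inter> \<Union>F = {}" using insert.prems(2)[of C] insert.hyps(2) by auto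
  have "m (\<Union>F) = (\<Sum>C\<in>F. m C)"
  proof (rule insert.IH)
    fix e assume e: "e \<in> E" "e \<subseteq> \<Union>F"
    then obtain D where D: "D \<in> insert C F" "e \<subseteq> D" using insert.prems(3)[of e] by auto
    have "e \<noteq> {}" using card_edge[OF e(1)] by auto
    then have "D \<noteq> C" using D(2) e(2) disj by blast
    then show "\<exists>D\<in>F. e \<subseteq> D" using D by blast
  qed (use insert.prems in auto)
  moreover have "m (C \<union> \<Union>F) = m C + m (\<Union>F)"
  proof (rule m_Un)
    fix e assume "e \<in> E" "e \<subseteq> C \<union> \<Union>F"
    then obtain D where "D \<in> insert C F" "e \<subseteq> D" using insert.prems(3)[of e] by auto
    then show "e \<subseteq> C \<or> e \<subseteq> \<Union>F" by auto
  qed (use insert.prems insert.hyps disj in auto)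
  ultimately show ?case using insert.hyps by simp
qed

lemma m_eq_sum_comps:
  assumes "finite S"
  shows "m S = (\<Sum>C\<in>comps S. m C)"
proof -
  have "m (\<Union>(comps S)) = (\<Sum>C\<in>comps S. m C)"
  proof (rule m_Union)
    show "finite C" if "C \<in> comps S" for C
      using comps_subset[OF that] assms finite_subset by blast
    show "\<exists>C\<in>comps S. e \<subseteq> C" if "e \<in> E" "e \<subseteq> \<Union>(comps S)" for e
      using edge_within_comps that by (simp add: Union_components)
  qed (use assms finite_comps components_disjoint in blast)+
  then show ?thesis by (simp add: Union_components)
qed

text \<open>The part \<open>S - C\<close> contributes the same summand before and after the
  deletion. The additive form covers a change of either sign.\<close>

lemma m_delete_comp:
  assumes fin: "finite S" and C: "C \<in> comps S" and u: "u \<in> C"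
  shows "m (S - {u}) + m C = m S + m (C - {u})"
proof -
  have CS: "C \<subseteq> S" by (rule comps_subset[OF C])
  have sep: "e \<subseteq> C \<or> e \<subseteq> S - C" if e: "e \<in> E" "e \<subseteq> S" for e
  proof -
    obtain D where D: "D \<in> comps S" "e \<subseteq> D" using edge_within_comps[OF e] by auto
    show ?thesis
    proof (cases "D = C")
      case False
      with components_disjoint[OF D(1) C] comps_subset[OF D(1)] D(2) show ?thesis by auto
    qed (use D in simp)
  qed
  have "m (C \<union> (S - C)) = m C + m (S - C)"
    using fin CS sep by (intro m_Un) (auto intro: finite_subset)
  moreover have "m ((C - {u}) \<union> (S - C)) = m (C - {u}) + m (S - C)"
  proof (rule m_Un)
    fix e assume e: "e \<in> E" "e \<subseteq> (C - {u}) \<union> (S - C)"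
    then have "e \<subseteq> S" using CS by auto
    from sep[OF e(1) this] e(2) u show "e \<subseteq> C - {u} \<or> e \<subseteq> S - C" by auto
  qed (use fin CS finite_subset in auto)
  moreover have "C \<union> (S - C) = S" "(C - {u}) \<union> (S - C) = S - {u}" using CS u by auto
  ultimately show ?thesis by simp
qed

section \<open>Counting critical components against the multiplicity\<close>

lemma critical_iff:
  "critical \<theta> C (induced_E E C) \<longleftrightarrow>
    connected_graph C (induced_E E C) \<and> (\<forall>u\<in>C. m (C - {u}) + 1 = m C)"
proof -
  have "del_verts_E (induced_E E C) {u} = induced_E E (C - {u})" for u
    by (auto simp: del_verts_E_def induced_E_def)
  then show ?thesis
    by (auto simp: critical_def essential_def mult_def del_verts_V_def m_def mp_def)
qed

lemma c_crit_eq: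
  "c_crit \<theta> S (induced_E E S) = card {C \<in> comps S. \<forall>u\<in>C. m (C - {u}) + 1 = m C}"
proof -
  have "critical \<theta> C (induced_E (induced_E E S) C) \<longleftrightarrow> (\<forall>u\<in>C. m (C - {u}) + 1 = m C)"
    if "C \<in> comps S" for C
    using that by (simp add: induced_E_induced_E comps_subset critical_iff connected_comps)
  then show ?thesis unfolding c_crit_def by (metis (no_types, lifting))
qed

text \<open>A critical component contains an essential vertex and so has multiplicity at least one;
  summing over components gives the bound.\<close>

lemma c_crit_le_m:
  assumes "finite S"
  shows "c_crit \<theta> S (induced_E E S) \<le> m S"
proof -
  have "m C \<ge> 1" if "C \<in> comps S" "\<forall>u\<in>C. m (C - {u}) + 1 = m C" for C
    using connected_comps[OF that(1)] that(2) by (auto simp: connected_graph_def)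
  then have "c_crit \<theta> S (induced_E E S) \<le> (\<Sum>C\<in>{C \<in> comps S. \<forall>u\<in>C. m (C - {u}) + 1 = m C}. m C)"
    unfolding c_crit_eq card_eq_sum by (intro sum_mono) auto
  also have "\<dots> \<le> m S"
    unfolding m_eq_sum_comps[OF assms] using assms by (intro sum_mono2) (auto intro: finite_comps)
  finally show ?thesis .
qed

text \<open>By \<open>m_delete_comp\<close> no vertex raises the multiplicity of its own component
  either. A component of positive multiplicity is therefore critical, and Gallai's lemma makes it
  count exactly once.\<close>

lemma c_crit_eq_m:
  assumes fin: "finite S" and np: "\<And>u. u \<in> S \<Longrightarrow> m (S - {u}) \<noteq> m S + 1"
  shows "c_crit \<theta> S (induced_E E S) = m S"
proof -
  let ?K = "{C \<in> comps S. \<forall>u\<in>C. m (C - {u}) + 1 = m C}"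
  have finC: "finite C" if "C \<in> comps S" for C
    using comps_subset[OF that] fin finite_subset by blast
  have 1: "m C = 1" if "C \<in> ?K" for C
    using that gallai[OF finC connected_comps] by auto
  have 0: "m C = 0" if "C \<in> comps S - ?K" for C
  proof (rule ccontr)
    assume "m C \<noteq> 0"
    have C: "C \<in> comps S" using that by simp
    have "m (C - {u}) \<noteq> m C + 1" if "u \<in> C" for u
      using m_delete_comp[OF fin C that] np[of u] comps_subset[OF C] that by auto
    then have "m (C - {u}) + 1 = m C" if "u \<in> C" for u
      using all_essential_if_no_positive[OF finC[OF C] connected_comps[OF C]] that \<open>m C \<noteq> 0\<close> by simp
    with that show False by auto
  qed
  have "m S = (\<Sum>C\<in>?K. m C)"
    unfolding m_eq_sum_comps[OF fin] using fin 0 finite_comps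
    by (intro sum.mono_neutral_right) auto
  also have "\<dots> = (\<Sum>C\<in>?K. 1)" using 1 by (rule sum.cong[OF refl])
  also have "\<dots> = card ?K" by simp
  finally show ?thesis by (simp add: c_crit_eq)
qed

lemma m_delete_set_le:
  assumes "finite X" "finite S" "X \<subseteq> S"
  shows "m (S - X) \<le> m S + card X"
  using assms
proof (induction X rule: finite_induct)
  case (insert x X)
  have "S - insert x X = S - X - {x}" by auto
  then have "m (S - insert x X) \<le> m (S - X) + 1"
    using m_delete_le[of "S - X" x] insert by simp
  also have "m (S - X) \<le> m S + card X" using insert by simp
  finally show ?case using insert.hyps by simp
qed simp

end

theorem theorem3p1:
  fixes V :: "'a set" and E :: "'a set set" and \<theta> :: real and X :: "'a set"
  assumes "simple_graph V E" and "X \<subseteq> V"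
  shows "maximal_tutte_set \<theta> V E X \<longleftrightarrow> maximal_extreme_set \<theta> V E X"
proof -
  have fin: "finite V" and E: "\<And>e. e \<in> E \<Longrightarrow> card e = 2 \<and> e \<subseteq> V"
    using assms(1) by (auto simp: simple_graph_def)
  interpret matching_graph E \<theta> by unfold_locales (use E in auto)
  have del: "del_verts_E E Y = induced_E E (V - Y)" for Y
    using E by (auto simp: del_verts_E_def induced_E_def)
  have mult_induced: "mult \<theta> S (induced_E E S) = m S" for S
    by (simp add: mult_def m_def mp_def)
  have "induced_E E V = E" using E by (auto simp: induced_E_def)
  then have m_V: "mult \<theta> V E = m V" using mult_induced[of V] by simp
  have tutte: "tutte_set \<theta> V E Y \<longleftrightarrow>
      Y \<subseteq> V \<and> c_crit \<theta> (V - Y) (induced_E E (V - Y)) = m V + card Y" for Y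
    by (simp add: tutte_set_def del del_verts_V_def m_V)
  have extreme: "extreme_set \<theta> V E Y \<longleftrightarrow> Y \<subseteq> V \<and> m (V - Y) = m V + card Y" for Y
    by (simp add: extreme_set_def del del_verts_V_def m_V mult_induced)
  have tutte_extreme: "extreme_set \<theta> V E Y" if "tutte_set \<theta> V E Y" for Y
  proof -
    from that have Y: "Y \<subseteq> V" "c_crit \<theta> (V - Y) (induced_E E (V - Y)) = m V + card Y"
      by (simp_all add: tutte)
    \<comment> \<open>For a Tutte set, \<open>m (V - Y)\<close> lies between the number of critical
      components and this bound, which coincide.\<close>
    have "m (V - Y) \<le> m V + card Y"
      using finite_subset[OF Y(1) fin] fin Y(1) by (rule m_delete_set_le)
    with c_crit_le_m[of "V - Y"] fin Y show ?thesis by (simp add: extreme)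
  qed
  have max_tutte: "tutte_set \<theta> V E Y" if "maximal_extreme_set \<theta> V E Y" for Y
  proof -
    have Y: "Y \<subseteq> V" "m (V - Y) = m V + card Y"
      and max: "\<And>Z. Y \<subset> Z \<Longrightarrow> \<not> extreme_set \<theta> V E Z"
      using that by (auto simp: maximal_extreme_set_def extreme)
    \<comment> \<open>A vertex raising the multiplicity could be added to \<open>Y\<close>, giving a
      larger extreme set.\<close>
    have "m (V - Y - {u}) \<noteq> m (V - Y) + 1" if "u \<in> V - Y" for u
    proof
      assume "m (V - Y - {u}) = m (V - Y) + 1"
      moreover have "V - Y - {u} = V - insert u Y" by auto
      moreover have "card (insert u Y) = card Y + 1"
        using that finite_subset[OF Y(1) fin] by simp
      ultimately have "extreme_set \<theta> V E (insert u Y)" using that Y by (simp add: extreme)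
      moreover have "Y \<subset> insert u Y" using that by auto
      ultimately show False using max by blast
    qed
    then show ?thesis using c_crit_eq_m[of "V - Y"] fin Y by (simp add: tutte)
  qed
  show ?thesis
  proof
    assume X: "maximal_tutte_set \<theta> V E X"
    then have ext: "extreme_set \<theta> V E X"
      by (simp add: maximal_tutte_set_def tutte_extreme)
    \<comment> \<open>Finiteness yields a maximal extreme set \<open>Y\<close> above
      \<open>X\<close>. It is a Tutte set, so maximality of \<open>X\<close> forces
      \<open>X = Y\<close>.\<close>
    have "finite {Y. extreme_set \<theta> V E Y}"
      by (rule finite_subset[of _ "Pow V"]) (use fin in \<open>auto simp: extreme\<close>)
    from finite_has_maximal2[OF this, of X] ext
    obtain Y where Y: "X \<subseteq> Y" "extreme_set \<theta> V E Y"
      and "\<forall>Z\<in>{Z. extreme_set \<theta> V E Z}. Y \<subseteq> Z \<longrightarrow> Y = Z" by auto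
    then have max: "maximal_extreme_set \<theta> V E Y"
      by (auto simp: maximal_extreme_set_def)
    with X Y(1) max_tutte have "X = Y" by (auto simp: maximal_tutte_set_def)
    with max show "maximal_extreme_set \<theta> V E X" by simp
  next
    assume "maximal_extreme_set \<theta> V E X"
    then have "tutte_set \<theta> V E X" "\<And>Y. X \<subset> Y \<Longrightarrow> \<not> extreme_set \<theta> V E Y"
      by (simp_all add: max_tutte) (simp add: maximal_extreme_set_def)
    then show "maximal_tutte_set \<theta> V E X"
      using tutte_extreme unfolding maximal_tutte_set_def by blast
  qed
qed

end
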